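(* Let $F:\{0,1\}^3\to\mathbb{Q}_{\ge0}$. The following are equivalent: (1) $F$ is windable; (2) for all $x_1,x_2,x_3\in\{0,1\}$, $F(x_1,x_2,x_3)F(1-x_1,1-x_2,1-x_3)\le F(x_1,x_2,1-x_3)F(1-x_1,1-x_2,x_3)+F(x_1,1-x_2,x_3)F(1-x_1,x_2,1-x_3)+F(x_1,1-x_2,1-x_3)F(1-x_1,x_2,x_3)$; (3) $F$ has a matchings circuit.
   Context: For $x,y\in\{0,1\}^J$, $x\oplus y$ is coordinatewise addition mod 2, and $\mathbf S$ is the characteristic vector of $S\subseteq J$. For $z\in\{0,1\}^J$, $\mathrm{Match}'(z)$ is the set of partitions of $\{i:z_i=1\}$ into blocks of size 1 or 2. $F:\{0,1\}^J\to\mathbb{Q}_{\ge0}$ is windable if there exist $B(x,y,M)\ge0$ for all $x,y\in\{0,1\}^J$ and $M\in\mathrm{Match}'(x\oplus y)$ with (1) $F(x)F(y)=\sum_{M\in\mathrm{Match}'(x\oplus y)}B(x,y,M)$ for all $x,y$, and (2) $B(x,y,M)=B(x\oplus\mathbf S,y\oplus\mathbf S,M)$ for all $x,y$ and all $S\in M\in\mathrm{Match}'(x\oplus y)$. A matchings circuit $G$ consists of: a finite set $J$ of incidences; a finite vertex set $V$ with sets $J_v$ partitioning $J$; a set $A\subseteq J$ of external edges; a partition $E$ of $J\setminus A$ into pairs (internal edges); a rational edge-weight $w(e)\ge0$ for each $e\in E$; and a rational fugacity $\lambda(v)\ge0$ for each $v$. For $F\subseteq A\cup E$, $\deg_F(v)$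 is the number of incidences in $J_v$ belonging to edges of $F$; $\mathrm{wt}_G(F)=0$ if some $\deg_F(v)\ge2$, else $\prod_{v:\deg_F(v)=0}\lambda(v)\prod_{e\in F\cap E}w(e)$. The signature $[\![G]\!]:\{0,1\}^A\to\mathbb{Q}_{\ge0}$ is $[\![G]\!](x)=\sum\mathrm{wt}_G(F)$ over $F\subseteq A\cup E$ with $F\cap A=\{a:x_a=1\}$. $F$ has a matchings circuit if $F=[\![G]\!]$ for some $G$ (with $A$ identified with $\{1,2,3\}$ via a bijection). *)

theory Defs
  imports Complex_Main "HOL-Library.Numeral_Type"
begin

text \<open>Vectors in {0,1}^J are functions J \<Rightarrow> bool (True = 1), J a finite type.\<close>

definition xorv :: "('j \<Rightarrow> bool) \<Rightarrow> ('j \<Rightarrow> bool) \<Rightarrow> ('j \<Rightarrow> bool)" where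
  "xorv x y = (\<lambda>i. x i \<noteq> y i)"

definition charv :: "'j set \<Rightarrow> ('j \<Rightarrow> bool)" where
  "charv S = (\<lambda>i. i \<in> S)"

definition Match' :: "('j \<Rightarrow> bool) \<Rightarrow> 'j set set set" where
  "Match' z = {M. (\<forall>S\<in>M. card S = 1 \<or> card S = 2) \<and> \<Union>M = {i. z i} \<and>
                  (\<forall>S\<in>M. \<forall>T\<in>M. S \<noteq> T \<longrightarrow> S \<inter> T = {})}"

definition windable :: "(('j::finite \<Rightarrow> bool) \<Rightarrow> rat) \<Rightarrow> bool" where
  "windable F \<longleftrightarrow> (\<exists>B :: ('j \<Rightarrow> bool) \<Rightarrow> ('j \<Rightarrow> bool) \<Rightarrow> 'j set set \<Rightarrow> rat.
     (\<forall>x y. \<forall>M\<in>Match' (xorv x y). B x y M \<ge> 0) \<and>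
     (\<forall>x y. F x * F y = (\<Sum>M\<in>Match' (xorv x y). B x y M)) \<and>
     (\<forall>x y. \<forall>M\<in>Match' (xorv x y). \<forall>S\<in>M.
        B x y M = B (xorv x (charv S)) (xorv y (charv S)) M))"

text \<open>Matchings circuits. Incidences and vertices are natural numbers.
  vert j is the vertex owning incidence j (so J_v = {j \<in> J. vert j = v});
  A \<subseteq> J are the external edges; E is a partition of J - A into pairs;
  w are edge weights, lam are fugacities.\<close>

definition is_matchings_circuit ::
  "nat set \<Rightarrow> nat set \<Rightarrow> (nat \<Rightarrow> nat) \<Rightarrow> nat set \<Rightarrow> nat set set \<Rightarrow> (nat set \<Rightarrow> rat) \<Rightarrow> (nat \<Rightarrow> rat) \<Rightarrow> bool"
  where
  "is_matchings_circuit J V vert A E w lam \<longleftrightarrow>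
     finite J \<and> finite V \<and> vert ` J \<subseteq> V \<and> A \<subseteq> J \<and>
     (\<forall>e\<in>E. card e = 2) \<and> (\<forall>e\<in>E. \<forall>e'\<in>E. e \<noteq> e' \<longrightarrow> e \<inter> e' = {}) \<and>
     \<Union>E = J - A \<and>
     (\<forall>e\<in>E. w e \<ge> 0) \<and> (\<forall>v\<in>V. lam v \<ge> 0)"

text \<open>deg_F(v) for F = FA \<union> FE with FA \<subseteq> A (external) and FE \<subseteq> E (internal).\<close>
definition mc_deg :: "(nat \<Rightarrow> nat) \<Rightarrow> nat set \<Rightarrow> nat set set \<Rightarrow> nat \<Rightarrow> nat" where
  "mc_deg vert FA FE v = card {j. vert j = v \<and> (j \<in> FA \<or> (\<exists>e\<in>FE. j \<in> e))}"

definition mc_wt ::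
  "nat set \<Rightarrow> (nat \<Rightarrow> nat) \<Rightarrow> (nat set \<Rightarrow> rat) \<Rightarrow> (nat \<Rightarrow> rat) \<Rightarrow> nat set \<Rightarrow> nat set set \<Rightarrow> rat" where
  "mc_wt V vert w lam FA FE =
     (if \<exists>v\<in>V. mc_deg vert FA FE v \<ge> 2 then 0
      else (\<Prod>v\<in>{v\<in>V. mc_deg vert FA FE v = 0}. lam v) * (\<Prod>e\<in>FE. w e))"

text \<open>Signature evaluated at the set X \<subseteq> A of external edges with x_a = 1.\<close>
definition mc_signature ::
  "nat set \<Rightarrow> (nat \<Rightarrow> nat) \<Rightarrow> nat set set \<Rightarrow> (nat set \<Rightarrow> rat) \<Rightarrow> (nat \<Rightarrow> rat) \<Rightarrow> nat set \<Rightarrow> rat" where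
  "mc_signature V vert E w lam X = (\<Sum>FE\<in>Pow E. mc_wt V vert w lam X FE)"

definition has_matchings_circuit :: "(('j::finite \<Rightarrow> bool) \<Rightarrow> rat) \<Rightarrow> bool" where
  "has_matchings_circuit F \<longleftrightarrow>
    (\<exists>J V vert A E w lam (\<sigma> :: 'j \<Rightarrow> nat).
       is_matchings_circuit J V vert A E w lam \<and> bij_betw \<sigma> UNIV A \<and>
       (\<forall>x. F x = mc_signature V vert E w lam (\<sigma> ` {i. x i})))"

definition vec3 :: "bool \<Rightarrow> bool \<Rightarrow> bool \<Rightarrow> (3 \<Rightarrow> bool)" where
  "vec3 a b c = (\<lambda>i. if i = 0 then a else if i = 1 then b else c)"

end

theory Submission
  imports Defs "HOL-Analysis.Cartesian_Space"
begin

text \<open>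
  (1) \<open>\<Longrightarrow>\<close> (2): a partition of three points into blocks of size at most 2 contains a singleton
  \<open>{i}\<close>, and moving along it turns a term of \<open>F x * F (1 - x)\<close> into a term of the product for the
  antipodal pair obtained by flipping \<open>x\<^sub>i\<close>.

  (3) \<open>\<Longrightarrow>\<close> (1): the symmetric difference of two matchings is a union of paths and cycles. Exchanging
  the two matchings along a path preserves the product of their weights, and a path has at most two
  external ends. The latter is a statement about dihedral groups: the incidences of the symmetric
  difference carry two involutions (other end of the edge, other incidence at the vertex), an
  external edge is a fixed point of the first one, and an orbit contains at most two of those.

  (2) \<open>\<Longrightarrow>\<close> (3): let \<open>g\<^sub>0, \<dots>, g\<^sub>3\<close> be the values of \<open>F\<close> at 111, 011, 101, 110 and \<open>h\<^sub>k\<close> the values at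
  the antipodes. The inequalities say that no \<open>g\<^sub>k h\<^sub>k\<close> exceeds the sum of the other three, so these
  products are the vertex sums of nonnegative edge weights on \<open>K\<^sub>4\<close>. If \<open>g \<noteq> 0\<close>, dividing by
  \<open>g\<^sub>k g\<^sub>l\<close> yields a symmetric \<open>c \<ge> 0\<close> with \<open>h\<^sub>k = \<Sum>\<^sub>l c\<^sub>k\<^sub>l g\<^sub>l\<close>, and a circuit whose graph is \<open>K\<^sub>5\<close>
  with edge weights \<open>g\<^sub>k\<close> and \<open>c\<^sub>k\<^sub>l\<close> has exactly the signature \<open>F\<close>. If \<open>g = 0\<close>, then \<open>F\<close> lives on
  vectors of weight at most 1 and a star-shaped circuit realises it.
\<close>

section \<open>Windable functions satisfy the antipodal inequality\<close>

text \<open>If every block had two elements, the disjoint union of the blocks would have even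
  size.\<close>

lemma Match'_odd_has_singleton:
  fixes z :: "'j::finite \<Rightarrow> bool"
  assumes M: "M \<in> Match' z" and odd: "odd (card {i. z i})"
  shows "\<exists>i. {i} \<in> M"
proof (rule ccontr)
  assume no: "\<not> ?thesis"
  have two: "card S = 2" if "S \<in> M" for S
  proof -
    have "card S = 1 \<or> card S = 2" using M that by (auto simp: Match'_def)
    moreover have "card S \<noteq> 1" using no that by (metis card_1_singletonE)
    ultimately show ?thesis by blast
  qed
  have "pairwise disjnt M" using M by (auto simp: Match'_def pairwise_def disjnt_def)
  then have "card (\<Union>M) = sum card M" by (intro card_Union_disjoint) auto
  also have "\<dots> = 2 * card M" using two by simp
  finally show False using M odd by (simp add: Match'_def)
qed

lemma windable_antipodal_le:
  fixes F :: "('j::finite \<Rightarrow> bool) \<Rightarrow> rat"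
  assumes "windable F" and odd: "odd CARD('j)"
  shows "F x * F (\<lambda>i. \<not> x i)
    \<le> (\<Sum>i\<in>UNIV. F (xorv x (charv {i})) * F (xorv (\<lambda>i. \<not> x i) (charv {i})))"
proof -
  obtain B where B:
    "\<forall>x y. \<forall>M\<in>Match' (xorv x y). B x y M \<ge> 0"
    "\<forall>x y. F x * F y = (\<Sum>M\<in>Match' (xorv x y). B x y M)"
    "\<forall>x y. \<forall>M\<in>Match' (xorv x y). \<forall>S\<in>M. B x y M = B (xorv x (charv S)) (xorv y (charv S)) M"
    using \<open>windable F\<close> unfolding windable_def by (elim exE conjE)
  note B0 = B(1)[rule_format] and B1 = B(2)[rule_format] and B2 = B(3)[rule_format]
  let ?y = "\<lambda>i. \<not> x i"
  let ?z = "\<lambda>i::'j. True"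
  let ?B = "\<lambda>i M. B (xorv x (charv {i})) (xorv ?y (charv {i})) M"
  have z: "xorv x ?y = ?z" "xorv (xorv x (charv S)) (xorv ?y (charv S)) = ?z" for S
    by (auto simp: xorv_def)
  \<comment> \<open>The index of the singleton block depends on \<open>M\<close>. Bounding by the
    sum over all \<open>i\<close> makes the estimate uniform in \<open>M\<close>, so that the two
    sums can be interchanged afterwards.\<close>
  have le: "B x ?y M \<le> (\<Sum>i\<in>UNIV. ?B i M)" if M: "M \<in> Match' ?z" for M
  proof -
    obtain i where i: "{i} \<in> M" using Match'_odd_has_singleton[OF M] odd by auto
    have "B x ?y M = ?B i M" using B2[of M x ?y "{i}"] M i z by simp
    also have "\<dots> \<le> (\<Sum>i\<in>UNIV. ?B i M)"
      by (rule member_le_sum) (use B0 M z in auto)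
    finally show ?thesis .
  qed
  have "F x * F ?y = (\<Sum>M\<in>Match' ?z. B x ?y M)" using B1[of x ?y] z by simp
  also have "\<dots> \<le> (\<Sum>M\<in>Match' ?z. \<Sum>i\<in>UNIV. ?B i M)" by (intro sum_mono le)
  also have "\<dots> = (\<Sum>i\<in>UNIV. \<Sum>M\<in>Match' ?z. ?B i M)" by (rule sum.swap)
  also have "\<dots> = (\<Sum>i\<in>UNIV. F (xorv x (charv {i})) * F (xorv ?y (charv {i})))"
    by (simp add: B1 z)
  finally show ?thesis .
qed

section \<open>Coordinates of ternary vectors\<close>

lemma exhaust_3_from_0: "i = 0 \<or> i = 1 \<or> i = 2" for i :: 3
proof -
  have "(3::3) = 0" by simp
  with exhaust_3[of i] show ?thesis by metis
qed

lemma UNIV_3_from_0: "(UNIV :: 3 set) = {0, 1, 2}"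
  using exhaust_3_from_0 by auto

lemma vec3_exhaust: "\<exists>a b c. x = vec3 a b c"
proof (intro exI ext)
  fix i :: 3
  show "x i = vec3 (x 0) (x 1) (x 2) i"
    using exhaust_3_from_0[of i] by (auto simp: vec3_def)
qed

lemma not_vec3: "(\<lambda>i. \<not> vec3 a b c i) = vec3 (\<not> a) (\<not> b) (\<not> c)"
  by (auto simp: vec3_def)

lemma xorv_vec3:
  "xorv (vec3 a b c) (charv {0}) = vec3 (\<not> a) b c"
  "xorv (vec3 a b c) (charv {1}) = vec3 a (\<not> b) c"
  "xorv (vec3 a b c) (charv {2}) = vec3 a b (\<not> c)"
  by (rule ext, use exhaust_3_from_0 in \<open>force simp: vec3_def xorv_def charv_def\<close>)+

section \<open>Signatures of matchings circuits are windable\<close>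

lemma funpow_inverse:
  fixes f g :: "'a \<Rightarrow> 'a"
  assumes "\<And>x. g (f x) = x"
  shows "(g ^^ n) ((f ^^ n) x) = x"
proof (induction n)
  case (Suc n)
  have "(g ^^ Suc n) ((f ^^ Suc n) x) = (g ^^ n) (g (f ((f ^^ n) x)))"
    by (simp add: funpow_swap1)
  then show ?case using Suc assms by simp
qed simp

text \<open>Because \<open>s\<close> fixes \<open>a\<close>, the powers of the rotation
  \<open>f = s t\<close> already sweep out the whole dihedral orbit of \<open>a\<close>. Reflection
  sends exponent \<open>n\<close> to \<open>-n\<close> modulo the period \<open>N\<close>, so a
  fixed point has exponent 0 or, for even \<open>N\<close>, \<open>N div 2\<close>.\<close>

lemma dihedral_orbit_two_fixed_points:
  fixes s t :: "'a \<Rightarrow> 'a"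
  assumes s: "\<And>x. s (s x) = x" and t: "\<And>x. t (t x) = x"
    and D: "finite D" "s ` D \<subseteq> D" "t ` D \<subseteq> D" and a: "a \<in> D" "s a = a"
  shows "\<exists>Q. a \<in> Q \<and> s ` Q \<subseteq> Q \<and> t ` Q \<subseteq> Q \<and> finite {b \<in> Q. s b = b} \<and> card {b \<in> Q. s b = b} \<le> 2"
proof -
  define f where "f = (\<lambda>x. s (t x))"
  define g where "g = (\<lambda>x. t (s x))"
  have gf: "g (f x) = x" and fg: "f (g x) = x" for x by (simp_all add: f_def g_def s t)
  have s_f: "s ((f ^^ n) a) = (g ^^ n) a" for n
  proof (induction n)
    case (Suc n)
    then show ?case by (metis (no_types, lifting) f_def funpow.simps(2) g_def o_apply s t)
  qed (simp add: a)
  have inD: "(f ^^ n) a \<in> D" for n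
    by (induction n) (use a D in \<open>auto simp: f_def\<close>)
  then have "range (\<lambda>n. (f ^^ n) a) \<subseteq> D" by blast
  then have "\<not> inj (\<lambda>n. (f ^^ n) a)"
    using D(1) finite_subset finite_imageD infinite_UNIV_nat by metis
  then obtain i j where "i < j" "(f ^^ i) a = (f ^^ j) a"
    unfolding inj_def by (metis linorder_neqE_nat)
  \<comment> \<open>Cancelling \<open>f ^^ i\<close>, which has the left inverse
    \<open>g ^^ i\<close>, turns a repetition in the sequence into a return to \<open>a\<close>
    itself.\<close>
  moreover have "(f ^^ j) a = (f ^^ i) ((f ^^ (j - i)) a)"
    using \<open>i < j\<close> by (metis comp_apply funpow_add le_add_diff_inverse less_imp_le)
  ultimately have per: "(f ^^ (j - i)) a = a"
    by (metis funpow_inverse gf)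
  define N where "N = (LEAST n. 0 < n \<and> (f ^^ n) a = a)"
  have "0 < j - i \<and> (f ^^ (j - i)) a = a" using \<open>i < j\<close> per by simp
  then have "0 < N \<and> (f ^^ N) a = a" unfolding N_def by (rule LeastI)
  then have N: "0 < N" "(f ^^ N) a = a" by auto
  have N_min: "N \<le> n" if "0 < n" "(f ^^ n) a = a" for n
    unfolding N_def using that by (intro Least_le) auto
  have mult: "(f ^^ (N * k)) a = a" for k
    by (induction k) (simp_all add: funpow_add N)
  have mod: "(f ^^ n) a = (f ^^ (n mod N)) a" for n
  proof -
    have "(f ^^ n) a = (f ^^ (n mod N + N * (n div N))) a" by simp
    also have "\<dots> = (f ^^ (n mod N)) a" by (simp only: funpow_add comp_apply mult)
    finally show ?thesis .
  qed
  \<comment> \<open>As \<open>s\<close> inverts the rotation \<open>f\<close>, a point \<open>f\<^sup>n a\<close> is fixed by \<open>s\<close> iff \<open>f\<^sup>2\<^sup>n a = a\<close>.\<close>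
  define Q where "Q = range (\<lambda>n. (f ^^ n) a)"
  have s_Q: "s ` Q \<subseteq> Q"
  proof
    fix y assume "y \<in> s ` Q"
    then obtain n where "y = (g ^^ n) a" by (auto simp: Q_def s_f)
    \<comment> \<open>The exponent is \<open>N * n\<close>, a multiple of the period and at least
      \<open>n\<close>, so a negative power of \<open>f\<close> becomes a nonnegative one.\<close>
    also have "\<dots> = (g ^^ n) ((f ^^ (n + (N * n - n))) a)" using N(1) by (simp add: mult)
    also have "\<dots> = (f ^^ (N * n - n)) a" by (simp only: funpow_add comp_apply funpow_inverse[of g f, OF gf])
    finally show "y \<in> Q" by (auto simp: Q_def)
  qed
  moreover have "t ` Q \<subseteq> Q"
  proof
    fix y assume "y \<in> t ` Q"
    then obtain n where "y = t ((f ^^ n) a)" by (auto simp: Q_def)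
    then have "y = s ((f ^^ Suc n) a)" by (simp add: f_def s)
    then show "y \<in> Q" using s_Q unfolding Q_def by blast
  qed
  moreover have "a \<in> Q" by (auto simp: Q_def intro: image_eqI[of _ _ 0])
  moreover have sub: "{b \<in> Q. s b = b} \<subseteq> {a, (f ^^ (N div 2)) a}"
  proof
    fix b assume "b \<in> {b \<in> Q. s b = b}"
    then obtain n where n: "b = (f ^^ n) a" "n < N" "s b = b"
      using mod N(1) unfolding Q_def by (metis (mono_tags, lifting) mem_Collect_eq mod_less_divisor rangeE)
    then have "(f ^^ n) a = (g ^^ n) a" using s_f by metis
    then have "(f ^^ (n + n)) a = a"
      by (simp add: funpow_add funpow_inverse[of f g, OF fg])
    then have "(f ^^ ((n + n) mod N)) a = a" using mod by metis
    then have "(n + n) mod N = 0"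
      using N_min[of "(n + n) mod N"] N(1) by (metis bot_nat_0.not_eq_extremum mod_less_divisor not_le)
    then have "n = 0 \<or> n = N div 2" using n(2)
      by (cases "n + n < N") (auto simp: mod_if[of "n + n"])
    then show "b \<in> {a, (f ^^ (N div 2)) a}" using n by auto
  qed
  moreover have "finite {b \<in> Q. s b = b}" using sub finite_subset by blast
  moreover have "card {b \<in> Q. s b = b} \<le> 2"
  proof -
    have "card {b \<in> Q. s b = b} \<le> card {a, (f ^^ (N div 2)) a}"
      by (rule card_mono) (use sub in auto)
    also have "\<dots> \<le> 2" by (simp add: card_insert_if)
    finally show ?thesis .
  qed
  ultimately show ?thesis by blast
qed

text \<open>The involution exchanges the two points of each two-element fibre and fixes everything
  else. It is the identity off \<open>D\<close>, so it is an involution of the whole type.\<close>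

lemma small_fibres_involution:
  fixes \<kappa> :: "'a \<Rightarrow> 'b"
  assumes fin: "finite D" and small: "\<And>x. x \<in> D \<Longrightarrow> card {y \<in> D. \<kappa> y = \<kappa> x} \<le> 2"
  shows "\<exists>t. (\<forall>x. t (t x) = x) \<and> (\<forall>x\<in>D. t x \<in> D \<and> \<kappa> (t x) = \<kappa> x) \<and>
    (\<forall>x\<in>D. \<forall>y\<in>D. \<kappa> x = \<kappa> y \<longrightarrow> y = x \<or> y = t x)"
proof -
  have uniq: "y = z"
    if "x \<in> D" "y \<in> D" "z \<in> D" "y \<noteq> x" "z \<noteq> x" "\<kappa> y = \<kappa> x" "\<kappa> z = \<kappa> x" for x y z
  proof (rule ccontr)
    assume "y \<noteq> z"
    then have "card {x, y, z} = 3" using that by simp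
    moreover have "card {x, y, z} \<le> card {y \<in> D. \<kappa> y = \<kappa> x}"
      by (rule card_mono) (use that fin in auto)
    ultimately show False using small[OF that(1)] by simp
  qed
  define P where "P x y \<longleftrightarrow> x \<in> D \<and> y \<in> D \<and> y \<noteq> x \<and> \<kappa> y = \<kappa> x" for x y
  define t where "t x = (if \<exists>y. P x y then SOME y. P x y else x)" for x
  have P_t: "P x (t x)" if "P x y" for x y
    unfolding t_def using that by (metis someI_ex)
  have t_eq: "t x = y" if "P x y" for x y
    using P_t[OF that] that uniq[of x "t x" y] unfolding P_def by metis
  have t_id: "t x = x" if "\<nexists>y. P x y" for x using that by (simp add: t_def)
  have P_sym: "P x y \<longleftrightarrow> P y x" for x y by (auto simp: P_def)
  have "t (t x) = x" for x
    using t_eq t_id P_sym by metis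
  moreover have "t x \<in> D" "\<kappa> (t x) = \<kappa> x" if "x \<in> D" for x
    using t_id[of x] P_t[of x] that unfolding P_def by metis+
  moreover have "y = x \<or> y = t x" if "x \<in> D" "y \<in> D" "\<kappa> x = \<kappa> y" for x y
    using t_eq[of x y] that by (auto simp: P_def)
  ultimately show ?thesis by blast
qed

section \<open>Weights of sets of incidences and their exchange\<close>

definition vertex_factor :: "(nat \<Rightarrow> rat) \<Rightarrow> nat \<Rightarrow> nat set \<Rightarrow> rat" where
  "vertex_factor lam v Y = (if card Y \<ge> 2 then 0 else if card Y = 0 then lam v else 1)"

text \<open>Here \<open>Y\<close> is the set of chosen incidences of \<open>e\<close>. A half-chosen
  edge counts 0, so that arbitrary sets of incidences can stand in for sets of edges.\<close>

definition edge_factor :: "(nat set \<Rightarrow> rat) \<Rightarrow> nat set \<Rightarrow> nat set \<Rightarrow> rat" where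
  "edge_factor w e Y = (if Y = e then w e else if Y = {} then 1 else 0)"

text \<open>With \<open>K\<close> a component of the symmetric difference, the pair
  \<open>swap_on K X Y\<close>, \<open>swap_on K Y X\<close> is the exchange of two configurations
  along a path or cycle.\<close>

definition swap_on :: "'a set \<Rightarrow> 'a set \<Rightarrow> 'a set \<Rightarrow> 'a set" where
  "swap_on K X Y = (X - K) \<union> (Y \<inter> K)"

lemma sym_diff_swap_on: "sym_diff (swap_on K X Y) (swap_on K Y X) = sym_diff X Y"
  by (auto simp: swap_on_def)

lemma swap_on_swap_on: "swap_on K (swap_on K X Y) (swap_on K Y X) = X"
  by (auto simp: swap_on_def)

text \<open>Off their symmetric difference \<open>X\<close> and \<open>Y\<close> agree, so seen from
  within \<open>C\<close> the exchange is either complete or void.\<close>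

lemma swap_on_cases:
  assumes "sym_diff X Y \<inter> C \<subseteq> K \<or> sym_diff X Y \<inter> C \<inter> K = {}"
  shows "(swap_on K X Y \<inter> C = X \<inter> C \<and> swap_on K Y X \<inter> C = Y \<inter> C) \<or>
    (swap_on K X Y \<inter> C = Y \<inter> C \<and> swap_on K Y X \<inter> C = X \<inter> C)"
  using assms unfolding swap_on_def by blast

locale matchings_circuit =
  fixes J V :: "nat set" and vert :: "nat \<Rightarrow> nat" and A :: "nat set" and E :: "nat set set"
    and w :: "nat set \<Rightarrow> rat" and lam :: "nat \<Rightarrow> rat"
  assumes circuit: "is_matchings_circuit J V vert A E w lam"
begin

lemma finite_J: "finite J" and finite_V: "finite V" and vert_J: "j \<in> J \<Longrightarrow> vert j \<in> V"
  and A_J: "A \<subseteq> J" and card_edge: "e \<in> E \<Longrightarrow> card e = 2"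
  and edge_eq: "\<lbrakk>e \<in> E; e' \<in> E; j \<in> e; j \<in> e'\<rbrakk> \<Longrightarrow> e = e'"
  and Union_E: "\<Union>E = J - A"
  and w_nonneg: "e \<in> E \<Longrightarrow> w e \<ge> 0" and lam_nonneg: "v \<in> V \<Longrightarrow> lam v \<ge> 0"
  using circuit unfolding is_matchings_circuit_def by blast+

lemma finite_E: "finite E"
  using finite_J Union_E by (metis finite_Diff finite_UnionD)

lemma edge_nonempty: "e \<in> E \<Longrightarrow> e \<noteq> {}"
  using card_edge by fastforce

definition weight :: "nat set \<Rightarrow> rat" where
  "weight X = (\<Prod>v\<in>V. vertex_factor lam v (X \<inter> vert -` {v})) * (\<Prod>e\<in>E. edge_factor w e (X \<inter> e))"

lemma weight_nonneg: "weight X \<ge> 0"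
  unfolding weight_def vertex_factor_def edge_factor_def
  by (intro mult_nonneg_nonneg prod_nonneg) (auto intro: w_nonneg lam_nonneg)

lemma weight_nonzeroD:
  assumes "weight X \<noteq> 0"
  shows "v \<in> V \<Longrightarrow> card (X \<inter> vert -` {v}) \<le> 1" and "e \<in> E \<Longrightarrow> e \<subseteq> X \<or> e \<inter> X = {}"
proof -
  have v: "\<forall>v\<in>V. vertex_factor lam v (X \<inter> vert -` {v}) \<noteq> 0"
    and e: "\<forall>e\<in>E. edge_factor w e (X \<inter> e) \<noteq> 0"
    using assms finite_V finite_E by (auto simp: weight_def)
  show "card (X \<inter> vert -` {v}) \<le> 1" if "v \<in> V"
    using bspec[OF v that] by (auto simp: vertex_factor_def split: if_splits)
  show "e \<subseteq> X \<or> e \<inter> X = {}" if "e \<in> E"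
    using bspec[OF e that] by (auto simp: edge_factor_def split: if_splits)
qed

lemma mc_wt_eq_weight:
  assumes "XA \<subseteq> A" "FE \<subseteq> E"
  shows "mc_wt V vert w lam XA FE = weight (XA \<union> \<Union>FE)"
proof -
  let ?X = "XA \<union> \<Union>FE"
  have deg: "mc_deg vert XA FE v = card (?X \<inter> vert -` {v})" for v
    unfolding mc_deg_def by (rule arg_cong[of _ _ card]) auto
  have "edge_factor w e (?X \<inter> e) = (if e \<in> FE then w e else 1)" if "e \<in> E" for e
  proof (cases "e \<in> FE")
    case True
    then have "?X \<inter> e = e" by auto
    then show ?thesis using True by (simp add: edge_factor_def)
  next
    case False
    have "e \<inter> A = {}" using that Union_E by auto
    moreover have "e \<inter> e' = {}" if "e' \<in> FE" for e'
      using edge_eq \<open>e \<in> E\<close> that False assms(2) by blast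
    ultimately have "?X \<inter> e = {}" using assms(1) by blast
    then show ?thesis using False edge_nonempty[OF that] by (simp add: edge_factor_def)
  qed
  then have "(\<Prod>e\<in>E. edge_factor w e (?X \<inter> e)) = (\<Prod>e\<in>E. if e \<in> FE then w e else 1)"
    by (rule prod.cong[OF refl])
  also have "\<dots> = (\<Prod>e\<in>FE. w e)"
    using assms(2) finite_E by (simp add: prod.inter_restrict[symmetric] Int_absorb1)
  finally have e: "(\<Prod>e\<in>E. edge_factor w e (?X \<inter> e)) = (\<Prod>e\<in>FE. w e)" .
  show ?thesis
  proof (cases "\<exists>v\<in>V. mc_deg vert XA FE v \<ge> 2")
    case True
    then obtain v where "v \<in> V" "vertex_factor lam v (?X \<inter> vert -` {v}) = 0"
      by (auto simp: vertex_factor_def deg)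
    then have "(\<Prod>v\<in>V. vertex_factor lam v (?X \<inter> vert -` {v})) = 0"
      using finite_V by (intro prod_zero) auto
    then show ?thesis using True by (simp add: mc_wt_def weight_def)
  next
    case False
    then have "(\<Prod>v\<in>V. vertex_factor lam v (?X \<inter> vert -` {v})) =
      (\<Prod>v\<in>V. if mc_deg vert XA FE v = 0 then lam v else 1)"
      by (intro prod.cong) (auto simp: vertex_factor_def deg)
    also have "\<dots> = (\<Prod>v\<in>{v\<in>V. mc_deg vert XA FE v = 0}. lam v)"
      using finite_V by (simp add: prod.inter_filter)
    finally show ?thesis using False e by (simp add: mc_wt_def weight_def)
  qed
qed

text \<open>Edges are nonempty and disjoint, so an edge set is determined by its incidences. Sets of
  incidences that do not arise in this way split some edge and have weight 0.\<close>

lemma mc_signature_eq_sum_weight: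
  assumes "XA \<subseteq> A"
  shows "mc_signature V vert E w lam XA = (\<Sum>X | X \<subseteq> J \<and> X \<inter> A = XA. weight X)"
proof -
  let ?X = "\<lambda>FE. XA \<union> \<Union>FE"
  have mem: "e \<in> FE" if FE: "FE \<subseteq> E" and e: "e \<in> E" "e \<subseteq> ?X FE" for e FE
  proof -
    obtain j where "j \<in> e" using edge_nonempty e by blast
    moreover have "j \<notin> A" using \<open>j \<in> e\<close> e Union_E by auto
    ultimately obtain e' where "j \<in> e'" "e' \<in> FE" using e assms by blast
    then show ?thesis using edge_eq[of e e' j] \<open>j \<in> e\<close> e FE by blast
  qed
  have "{e \<in> E. e \<subseteq> ?X FE} = FE" if "FE \<subseteq> E" for FE using mem that by blast
  then have inj: "inj_on ?X (Pow E)" by (intro inj_onI) (metis PowD)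
  have zero: "weight X = 0" if X: "X \<subseteq> J" "X \<inter> A = XA" "X \<notin> ?X ` Pow E" for X
  proof (rule ccontr)
    assume "weight X \<noteq> 0"
    then have "e \<subseteq> X \<or> e \<inter> X = {}" if "e \<in> E" for e using weight_nonzeroD(2) that by blast
    moreover have "X \<subseteq> XA \<union> \<Union>E" using X Union_E by blast
    ultimately have "X = ?X {e \<in> E. e \<subseteq> X}" using X(2) by blast
    then show False using X(3) by blast
  qed
  have "(\<Sum>X | X \<subseteq> J \<and> X \<inter> A = XA. weight X) = (\<Sum>X\<in>?X ` Pow E. weight X)"
  proof (rule sum.mono_neutral_right)
    show "finite {X. X \<subseteq> J \<and> X \<inter> A = XA}" using finite_J by simp
    show "?X ` Pow E \<subseteq> {X. X \<subseteq> J \<and> X \<inter> A = XA}" using assms A_J Union_E by blast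
  qed (use zero in blast)
  also have "\<dots> = (\<Sum>FE\<in>Pow E. weight (?X FE))" by (simp add: sum.reindex[OF inj])
  also have "\<dots> = mc_signature V vert E w lam XA"
    unfolding mc_signature_def by (intro sum.cong) (simp_all add: mc_wt_eq_weight assms)
  finally show ?thesis by simp
qed

text \<open>The weight is a product of local factors, and at each vertex and each edge the exchange
  either changes nothing or interchanges the two factors.\<close>

lemma weight_swap_on:
  assumes "\<And>v. sym_diff X Y \<inter> vert -` {v} \<subseteq> K \<or> sym_diff X Y \<inter> vert -` {v} \<inter> K = {}"
    and "\<And>e. e \<in> E \<Longrightarrow> sym_diff X Y \<inter> e \<subseteq> K \<or> sym_diff X Y \<inter> e \<inter> K = {}"
  shows "weight (swap_on K X Y) * weight (swap_on K Y X) = weight X * weight Y"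
proof -
  have eq: "weight X * weight Y =
    (\<Prod>v\<in>V. vertex_factor lam v (X \<inter> vert -` {v}) * vertex_factor lam v (Y \<inter> vert -` {v})) *
    (\<Prod>e\<in>E. edge_factor w e (X \<inter> e) * edge_factor w e (Y \<inter> e))" for X Y
    by (simp add: weight_def prod.distrib mult_ac)
  have "vertex_factor lam v (swap_on K X Y \<inter> vert -` {v}) * vertex_factor lam v (swap_on K Y X \<inter> vert -` {v})
    = vertex_factor lam v (X \<inter> vert -` {v}) * vertex_factor lam v (Y \<inter> vert -` {v})" for v
    using swap_on_cases[OF assms(1)[of v]] by (auto simp: mult.commute)
  moreover have "edge_factor w e (swap_on K X Y \<inter> e) * edge_factor w e (swap_on K Y X \<inter> e)
    = edge_factor w e (X \<inter> e) * edge_factor w e (Y \<inter> e)" if "e \<in> E" for e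
    using swap_on_cases[OF assms(2)[OF that]] by (auto simp: mult.commute)
  ultimately show ?thesis unfolding eq by (simp cong: prod.cong)
qed

section \<open>Components of the symmetric difference\<close>

definition link :: "nat set \<Rightarrow> (nat \<times> nat) set" where
  "link D = {(p, q). p \<in> D \<and> q \<in> D \<and> (vert p = vert q \<or> (\<exists>e\<in>E. p \<in> e \<and> q \<in> e))}"

definition component :: "nat set \<Rightarrow> nat \<Rightarrow> nat set" where
  "component D a = (link D)\<^sup>* `` {a}"

lemma sym_link: "sym (link D)"
  by (auto simp: sym_def link_def)

lemma component_self: "a \<in> component D a"
  by (simp add: component_def)

lemma component_eq: "b \<in> component D a \<Longrightarrow> component D b = component D a"
  using sym_rtrancl[OF sym_link[of D]] unfolding component_def sym_def
  by (auto intro: rtrancl_trans)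

lemma component_subset: "a \<in> D \<Longrightarrow> component D a \<subseteq> D"
  unfolding component_def by (auto elim: rtranclE simp: link_def)

lemma component_step: "p \<in> component D a \<Longrightarrow> (p, q) \<in> link D \<Longrightarrow> q \<in> component D a"
  unfolding component_def by (auto intro: rtrancl_into_rtrancl)

lemma component_minimal:
  assumes "a \<in> Q" "\<And>p q. p \<in> Q \<Longrightarrow> (p, q) \<in> link D \<Longrightarrow> q \<in> Q"
  shows "component D a \<subseteq> Q"
proof
  fix b assume "b \<in> component D a"
  then have "(a, b) \<in> (link D)\<^sup>*" by (simp add: component_def)
  then show "b \<in> Q" by induction (use assms in auto)
qed

lemma component_closed:
  "D \<inter> vert -` {v} \<subseteq> component D a \<or> D \<inter> vert -` {v} \<inter> component D a = {}"
  "e \<in> E \<Longrightarrow> D \<inter> e \<subseteq> component D a \<or> D \<inter> e \<inter> component D a = {}"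
  using component_step[of _ D a] by (auto simp: link_def)

text \<open>Passing to the other incidence of the edge and to the other one at the vertex gives
  involutions \<open>s\<close> and \<open>t\<close> on \<open>D\<close>. The component lies in any
  set containing \<open>a\<close> and closed under both, and its external incidences are fixed by
  \<open>s\<close>.\<close>

lemma card_comp_external:
  assumes D: "D \<subseteq> J" and deg: "\<And>v. v \<in> V \<Longrightarrow> card (D \<inter> vert -` {v}) \<le> 2"
    and edge: "\<And>e. e \<in> E \<Longrightarrow> e \<subseteq> D \<or> e \<inter> D = {}"
    and a: "a \<in> D \<inter> A"
  shows "card (component D a \<inter> A) \<le> 2"
proof -
  \<comment> \<open>For \<open>j\<close> in \<open>J\<close> this is the edge of \<open>j\<close>,
    an external edge being represented by its single incidence.\<close>
  define \<kappa> where "\<kappa> j = {j} \<union> \<Union>{e \<in> E. j \<in> e}" for j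
  have \<kappa>_E: "\<kappa> j = e" if "e \<in> E" "j \<in> e" for j e
    using that edge_eq unfolding \<kappa>_def by blast
  have \<kappa>_A: "\<kappa> j = {j}" if "j \<in> A" for j
    using that Union_E unfolding \<kappa>_def by blast
  have self: "j \<in> \<kappa> j" for j by (simp add: \<kappa>_def)
  have finD: "finite D" using D finite_J finite_subset by blast
  have "card {y \<in> D. vert y = vert x} \<le> 2" if "x \<in> D" for x
  proof -
    have "{y \<in> D. vert y = vert x} = D \<inter> vert -` {vert x}" by auto
    then show ?thesis using deg[of "vert x"] vert_J D that by auto
  qed
  from small_fibres_involution[OF finD this] obtain t
    where t: "\<forall>x. t (t x) = x" "\<forall>x\<in>D. t x \<in> D \<and> vert (t x) = vert x"
      "\<forall>x\<in>D. \<forall>y\<in>D. vert x = vert y \<longrightarrow> y = x \<or> y = t x" by blast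
  have "card {y \<in> D. \<kappa> y = \<kappa> x} \<le> 2" if x: "x \<in> D" for x
  proof -
    have fin: "finite (\<kappa> x)" and "card (\<kappa> x) \<le> 2"
    proof -
      consider "x \<in> A" | e where "e \<in> E" "x \<in> e" using x D Union_E by blast
      then have "finite (\<kappa> x) \<and> card (\<kappa> x) \<le> 2"
      proof cases
        case 1
        then show ?thesis by (simp add: \<kappa>_A)
      next
        case 2
        then show ?thesis using \<kappa>_E[OF 2] card_edge[of e] card_ge_0_finite[of e] by simp
      qed
      then show "finite (\<kappa> x)" "card (\<kappa> x) \<le> 2" by auto
    qed
    moreover have "card {y \<in> D. \<kappa> y = \<kappa> x} \<le> card (\<kappa> x)"
      by (rule card_mono[OF fin]) (use self in auto)
    ultimately show ?thesis by simp
  qed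
  from small_fibres_involution[OF finD this] obtain s
    where s: "\<forall>x. s (s x) = x" "\<forall>x\<in>D. s x \<in> D \<and> \<kappa> (s x) = \<kappa> x"
      "\<forall>x\<in>D. \<forall>y\<in>D. \<kappa> x = \<kappa> y \<longrightarrow> y = x \<or> y = s x" by blast
  have s_fix: "s j = j" if "j \<in> D" "j \<in> A" for j
    using s(2) that \<kappa>_A[OF that(2)] self[of "s j"] by auto
  obtain Q where Q: "a \<in> Q" "s ` Q \<subseteq> Q" "t ` Q \<subseteq> Q"
      and two: "finite {b \<in> Q. s b = b}" "card {b \<in> Q. s b = b} \<le> 2"
  proof -
    have "s ` D \<subseteq> D" "t ` D \<subseteq> D" "a \<in> D" "s a = a" using s(2) t(2) s_fix a by auto
    from dihedral_orbit_two_fixed_points[OF s(1)[rule_format] t(1)[rule_format] finD this]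
    show thesis using that by (elim exE conjE)
  qed
  have "component D a \<subseteq> Q"
  proof (rule component_minimal[OF Q(1)])
    fix p q assume "p \<in> Q" and pq: "(p, q) \<in> link D"
    have "\<kappa> p = \<kappa> q \<or> vert p = vert q" using pq \<kappa>_E by (auto simp: link_def)
    then have "q = p \<or> q = s p \<or> q = t p" using pq s(3) t(3) by (auto simp: link_def)
    then show "q \<in> Q" using \<open>p \<in> Q\<close> Q by auto
  qed
  then have "component D a \<inter> A \<subseteq> {b \<in> Q. s b = b}"
    using s_fix component_subset a by blast
  then show ?thesis using card_mono[OF two(1)] two(2) order_trans by blast
qed

text \<open>The value \<open>B x y M\<close> collects the pairs of configurations whose symmetric
  difference connects the external edges as \<open>M\<close> prescribes. Exchanging along the
  component that carries \<open>S\<close> is a weight-preserving bijection and gives the second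
  condition.\<close>

theorem windable_signature:
  fixes \<sigma> :: "'j::finite \<Rightarrow> nat"
  assumes bij: "bij_betw \<sigma> UNIV A"
    and F: "\<And>x. F x = mc_signature V vert E w lam (\<sigma> ` {i. x i})"
  shows "windable F"
proof -
  have inj: "inj \<sigma>" and ran: "range \<sigma> = A" using bij by (auto simp: bij_betw_def)
  define trace where "trace K = {i. \<sigma> i \<in> K}" for K
  define blocks where "blocks D = (\<lambda>i. trace (component D (\<sigma> i))) ` trace D" for D
  define cfg where "cfg x = {X. X \<subseteq> J \<and> X \<inter> A = \<sigma> ` {i. x i}}" for x
  define B where "B x y M = (\<Sum>(X, Y) | (X, Y) \<in> cfg x \<times> cfg y \<and> blocks (sym_diff X Y) = M.
    weight X * weight Y)" for x y M
  have fin_cfg: "finite (cfg x)" for x using finite_J by (simp add: cfg_def)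
  have cfg_mem: "\<sigma> i \<in> X \<longleftrightarrow> x i" if "X \<in> cfg x" for X x i
  proof -
    have "\<sigma> i \<in> X \<longleftrightarrow> \<sigma> i \<in> \<sigma> ` {i. x i}" using that ran unfolding cfg_def by blast
    then show ?thesis using inj by (simp add: inj_image_mem_iff)
  qed
  have cfgI: "X \<in> cfg x" if "X \<subseteq> J" "\<And>i. \<sigma> i \<in> X \<longleftrightarrow> x i" for X x
    using that ran by (auto simp: cfg_def)
  have F_sum: "F x = (\<Sum>X\<in>cfg x. weight X)" for x
    unfolding F cfg_def by (rule mc_signature_eq_sum_weight) (use ran in auto)
  have trace_D: "trace (sym_diff X Y) = {i. xorv x y i}" if "X \<in> cfg x" "Y \<in> cfg y" for X Y x y
    using cfg_mem[OF that(1)] cfg_mem[OF that(2)] by (auto simp: trace_def xorv_def)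
  have trace_comp: "trace (component D (\<sigma> i)) \<subseteq> trace D" if "i \<in> trace D" for D i
    using component_subset[of "\<sigma> i" D] that by (auto simp: trace_def)
  \<comment> \<open>Nonzero weights bound the degrees in the symmetric difference by 2. Other pairs
    may have larger blocks, but they contribute nothing to \<open>F x * F y\<close>.\<close>
  have Match: "blocks (sym_diff X Y) \<in> Match' (xorv x y)"
    if X: "X \<in> cfg x" "weight X \<noteq> 0" and Y: "Y \<in> cfg y" "weight Y \<noteq> 0" for x y X Y
  proof -
    let ?D = "sym_diff X Y"
    have fin: "finite X" "finite Y" using X Y finite_J by (auto simp: cfg_def intro: finite_subset)
    have D: "?D \<subseteq> J" using X Y by (auto simp: cfg_def)
    have deg: "card (?D \<inter> vert -` {v}) \<le> 2" if "v \<in> V" for v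
    proof -
      have "card (?D \<inter> vert -` {v}) \<le> card (X \<inter> vert -` {v} \<union> Y \<inter> vert -` {v})"
        by (rule card_mono) (use fin in auto)
      also have "\<dots> \<le> card (X \<inter> vert -` {v}) + card (Y \<inter> vert -` {v})" by (rule card_Un_le)
      finally show ?thesis
        using weight_nonzeroD(1)[OF X(2) that] weight_nonzeroD(1)[OF Y(2) that] by simp
    qed
    have edge: "e \<subseteq> ?D \<or> e \<inter> ?D = {}" if "e \<in> E" for e
      using weight_nonzeroD(2)[OF X(2) that] weight_nonzeroD(2)[OF Y(2) that] by blast
    have "card (trace (component ?D (\<sigma> i))) = 1 \<or> card (trace (component ?D (\<sigma> i))) = 2" if "i \<in> trace ?D" for i
    proof -
      have "\<sigma> ` trace (component ?D (\<sigma> i)) = component ?D (\<sigma> i) \<inter> A" using ran by (auto simp: trace_def)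
      then have "card (trace (component ?D (\<sigma> i))) = card (component ?D (\<sigma> i) \<inter> A)"
        using inj by (metis card_image inj_on_subset subset_UNIV)
      moreover have "card (component ?D (\<sigma> i) \<inter> A) \<le> 2"
        by (rule card_comp_external[OF D deg edge]) (use that ran in \<open>auto simp: trace_def\<close>)
      moreover have "i \<in> trace (component ?D (\<sigma> i))" by (simp add: trace_def component_self)
      then have "card (trace (component ?D (\<sigma> i))) \<noteq> 0" by (metis card_eq_0_iff empty_iff finite)
      ultimately show ?thesis by linarith
    qed
    moreover have "\<Union>(blocks ?D) = trace ?D"
    proof
      show "\<Union>(blocks ?D) \<subseteq> trace ?D" unfolding blocks_def using trace_comp[of _ ?D] by blast
      have "i \<in> trace (component ?D (\<sigma> i))" for i by (simp add: trace_def component_self)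
      then show "trace ?D \<subseteq> \<Union>(blocks ?D)" unfolding blocks_def by blast
    qed
    moreover have "S \<inter> T = {}" if "S \<in> blocks ?D" "T \<in> blocks ?D" "S \<noteq> T" for S T
    proof (rule ccontr)
      assume "S \<inter> T \<noteq> {}"
      then obtain l where l: "l \<in> S" "l \<in> T" by blast
      have "U = trace (component ?D (\<sigma> l))" if "U \<in> blocks ?D" "l \<in> U" for U
        using that component_eq[of "\<sigma> l" ?D] unfolding blocks_def trace_def by auto
      then show False using that l by blast
    qed
    moreover have "\<exists>i\<in>trace ?D. S = trace (component ?D (\<sigma> i))" if "S \<in> blocks ?D" for S
      using that by (auto simp: blocks_def)
    ultimately show ?thesis
      unfolding Match'_def trace_D[OF X(1) Y(1)] by blast
  qed
  have "F x * F y = (\<Sum>M\<in>Match' (xorv x y). B x y M)" for x y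
  proof -
    let ?f = "\<lambda>(X, Y). weight X * weight Y" and ?g = "\<lambda>(X, Y). blocks (sym_diff X Y)"
    let ?P = "{p \<in> cfg x \<times> cfg y. ?g p \<in> Match' (xorv x y)}"
    have "F x * F y = (\<Sum>p\<in>cfg x \<times> cfg y. ?f p)"
      by (simp add: F_sum sum_product sum.cartesian_product)
    also have "\<dots> = (\<Sum>p\<in>?P. ?f p)"
      by (rule sum.mono_neutral_right) (use fin_cfg Match in auto)
    also have "\<dots> = (\<Sum>M\<in>Match' (xorv x y). \<Sum>p | p \<in> ?P \<and> ?g p = M. ?f p)"
      by (rule sum.group[symmetric]) (use fin_cfg in auto)
    also have "\<dots> = (\<Sum>M\<in>Match' (xorv x y). B x y M)"
      unfolding B_def by (intro sum.cong) auto
    finally show ?thesis .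
  qed
  moreover have "B x y M \<ge> 0" for x y M
    unfolding B_def by (intro sum_nonneg) (auto intro: weight_nonneg mult_nonneg_nonneg)
  moreover have "B x y M = B (xorv x (charv S)) (xorv y (charv S)) M"
    if M: "M \<in> Match' (xorv x y)" and S: "S \<in> M" for x y M S
  proof -
    \<comment> \<open>The choice depends on the symmetric difference alone, which the exchange
      preserves. Hence \<open>\<phi>\<close> uses the same component again and is its own
      inverse.\<close>
    define K where "K D = component D (\<sigma> (SOME i. i \<in> trace D \<and> trace (component D (\<sigma> i)) = S))" for D
    have trace_K: "trace (K D) = S" if "blocks D = M" for D
    proof -
      have "\<exists>i. i \<in> trace D \<and> trace (component D (\<sigma> i)) = S" using S that unfolding blocks_def by blast
      then show ?thesis unfolding K_def by (metis (mono_tags, lifting) someI_ex)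
    qed
    define \<phi> where "\<phi> = (\<lambda>(X, Y). (swap_on (K (sym_diff X Y)) X Y, swap_on (K (sym_diff X Y)) Y X))"
    have inv: "\<phi> (\<phi> p) = p" for p
      by (cases p) (simp only: \<phi>_def prod.case sym_diff_swap_on swap_on_swap_on)
    have wt: "weight (fst (\<phi> p)) * weight (snd (\<phi> p)) = weight (fst p) * weight (snd p)" for p
      unfolding \<phi>_def case_prod_unfold fst_conv snd_conv
      by (rule weight_swap_on) (unfold K_def, (rule component_closed; assumption?)+)
    have D: "sym_diff (fst (\<phi> p)) (snd (\<phi> p)) = sym_diff (fst p) (snd p)" for p
      unfolding \<phi>_def case_prod_unfold fst_conv snd_conv by (rule sym_diff_swap_on)
    \<comment> \<open>On \<open>S\<close> the vectors \<open>x\<close> and \<open>y\<close> differ,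
      so interchanging their entries there flips both. The claim is for arbitrary \<open>x\<close>
      and \<open>y\<close> because it serves both directions of the bijection.\<close>
    have cfg_\<phi>: "fst (\<phi> p) \<in> cfg (xorv x (charv S)) \<and> snd (\<phi> p) \<in> cfg (xorv y (charv S))"
      if p: "fst p \<in> cfg x" "snd p \<in> cfg y" and b: "blocks (sym_diff (fst p) (snd p)) = M"
      and S_xy: "\<And>i. i \<in> S \<Longrightarrow> xorv x y i" for p x y
    proof -
      have K: "\<sigma> i \<in> K (sym_diff (fst p) (snd p)) \<longleftrightarrow> i \<in> S" for i
        using trace_K[OF b] by (auto simp: trace_def)
      show ?thesis
      proof (intro conjI cfgI)
        show "fst (\<phi> p) \<subseteq> J" "snd (\<phi> p) \<subseteq> J"
          using p by (auto simp: \<phi>_def case_prod_unfold swap_on_def cfg_def)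
        show "\<sigma> i \<in> fst (\<phi> p) \<longleftrightarrow> xorv x (charv S) i" "\<sigma> i \<in> snd (\<phi> p) \<longleftrightarrow> xorv y (charv S) i" for i
          using cfg_mem[OF p(1), of i] cfg_mem[OF p(2), of i] K[of i] S_xy[of i]
          by (auto simp: \<phi>_def case_prod_unfold swap_on_def xorv_def charv_def)
      qed
    qed
    have S_xy: "xorv x y i" if "i \<in> S" for i using M S that by (auto simp: Match'_def)
    have S_xy': "xorv (xorv x (charv S)) (xorv y (charv S)) i" if "i \<in> S" for i
      using S_xy[OF that] by (auto simp: xorv_def)
    have twice: "xorv (xorv z (charv S)) (charv S) = z" for z by (auto simp: xorv_def)
    show ?thesis unfolding B_def
    proof (rule sum.reindex_bij_witness[of _ \<phi> \<phi>])
      fix p assume "p \<in> {(X, Y). (X, Y) \<in> cfg x \<times> cfg y \<and> blocks (sym_diff X Y) = M}"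
      then have p: "fst p \<in> cfg x" "snd p \<in> cfg y" "blocks (sym_diff (fst p) (snd p)) = M" by auto
      show "\<phi> (\<phi> p) = p" by (rule inv)
      show "\<phi> p \<in> {(X, Y). (X, Y) \<in> cfg (xorv x (charv S)) \<times> cfg (xorv y (charv S)) \<and> blocks (sym_diff X Y) = M}"
        using cfg_\<phi>[OF p S_xy] D[of p] p(3) by (simp add: case_prod_unfold mem_Times_iff)
      show "(case \<phi> p of (X, Y) \<Rightarrow> weight X * weight Y) = (case p of (X, Y) \<Rightarrow> weight X * weight Y)"
        using wt[of p] by (simp add: case_prod_unfold)
    next
      fix p assume "p \<in> {(X, Y). (X, Y) \<in> cfg (xorv x (charv S)) \<times> cfg (xorv y (charv S)) \<and> blocks (sym_diff X Y) = M}"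
      then have p: "fst p \<in> cfg (xorv x (charv S))" "snd p \<in> cfg (xorv y (charv S))"
        "blocks (sym_diff (fst p) (snd p)) = M" by auto
      show "\<phi> (\<phi> p) = p" by (rule inv)
      show "\<phi> p \<in> {(X, Y). (X, Y) \<in> cfg x \<times> cfg y \<and> blocks (sym_diff X Y) = M}"
        using cfg_\<phi>[OF p S_xy'] D[of p] p(3) by (simp add: case_prod_unfold mem_Times_iff twice)
    qed
  qed
  ultimately show ?thesis unfolding windable_def by (intro exI[of _ B]) blast
qed

end

lemma has_matchings_circuit_windable:
  assumes "has_matchings_circuit F"
  shows "windable F"
proof -
  obtain J V vert A E w lam \<sigma> where "is_matchings_circuit J V vert A E w lam"
    "bij_betw \<sigma> UNIV A" "\<forall>x. F x = mc_signature V vert E w lam (\<sigma> ` {i. x i})"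
    using assms unfolding has_matchings_circuit_def by blast
  then show ?thesis by (intro matchings_circuit.windable_signature) (auto simp: matchings_circuit_def)
qed

section \<open>Circuits from weighted graphs\<close>

text \<open>For the degrees, the incidences of a chosen internal edge are no different from external
  ones. Moving them into \<open>X\<close> lets the edges be processed one at a time.\<close>

lemma mc_wt_insert_edge:
  assumes "finite FE" "e \<notin> FE"
  shows "mc_wt V vert w lam X (insert e FE) = w e * mc_wt V vert w lam (X \<union> e) FE"
proof -
  have "mc_deg vert X (insert e FE) v = mc_deg vert (X \<union> e) FE v" for v
    unfolding mc_deg_def by (rule arg_cong[of _ _ card]) auto
  then show ?thesis using assms by (simp add: mc_wt_def)
qed

lemma mc_signature_insert_edge:
  assumes "finite E" "e \<notin> E"
  shows "mc_signature V vert (insert e E) w lam X =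
    mc_signature V vert E w lam X + w e * mc_signature V vert E w lam (X \<union> e)"
proof -
  have "mc_signature V vert (insert e E) w lam X =
      mc_signature V vert E w lam X + (\<Sum>FE\<in>insert e ` Pow E. mc_wt V vert w lam X FE)"
    unfolding mc_signature_def Pow_insert
    by (rule sum.union_disjoint) (use assms in auto)
  also have "(\<Sum>FE\<in>insert e ` Pow E. mc_wt V vert w lam X FE)
      = (\<Sum>FE\<in>Pow E. mc_wt V vert w lam X (insert e FE))"
    by (rule sum.reindex_cong[of "insert e"]) (use assms in \<open>auto simp: inj_on_def\<close>)
  also have "\<dots> = (\<Sum>FE\<in>Pow E. w e * mc_wt V vert w lam (X \<union> e) FE)"
  proof (intro sum.cong refl mc_wt_insert_edge)
    fix FE assume "FE \<in> Pow E"
    then show "finite FE" "e \<notin> FE" using assms finite_subset by auto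
  qed
  finally show ?thesis by (simp add: mc_signature_def sum_distrib_left)
qed

lemma mc_signature_conflict:
  assumes "finite E" "\<And>e. e \<in> E \<Longrightarrow> finite e" "finite X"
    and "i \<in> X" "j \<in> X" "i \<noteq> j" "vert i = vert j" "vert i \<in> V"
  shows "mc_signature V vert E w lam X = 0"
proof -
  have "mc_wt V vert w lam X FE = 0" if "FE \<subseteq> E" for FE
  proof -
    let ?I = "{k. vert k = vert i \<and> (k \<in> X \<or> (\<exists>e\<in>FE. k \<in> e))}"
    have "?I \<subseteq> X \<union> \<Union>FE" by auto
    moreover have "finite (X \<union> \<Union>FE)" using assms that finite_subset by (metis finite_Un finite_Union subsetD)
    ultimately have "finite ?I" by (rule finite_subset)
    then have "card {i, j} \<le> card ?I" by (rule card_mono) (use assms in auto)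
    then have "2 \<le> mc_deg vert X FE (vert i)" using assms by (simp add: mc_deg_def)
    then show ?thesis using assms by (auto simp: mc_wt_def)
  qed
  then show ?thesis by (simp add: mc_signature_def)
qed

lemma mc_signature_no_edges:
  assumes "inj_on vert X" "finite X"
  shows "mc_signature V vert {} w lam X = (\<Prod>v\<in>V - vert ` X. lam v)"
proof -
  have deg: "mc_deg vert X {} v = (if v \<in> vert ` X then 1 else 0)" for v
  proof (cases "v \<in> vert ` X")
    case True
    then obtain i where "i \<in> X" "v = vert i" by auto
    then have "{j. vert j = v \<and> (j \<in> X \<or> (\<exists>e\<in>{}. j \<in> e))} = {i}" using assms by (auto simp: inj_on_def)
    then show ?thesis using True by (simp add: mc_deg_def)
  next
    case False
    then have none: "{j. vert j = v \<and> (j \<in> X \<or> (\<exists>e\<in>{}. j \<in> e))} = {}" by auto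
    show ?thesis using False unfolding mc_deg_def none by simp
  qed
  have "{v \<in> V. mc_deg vert X {} v = 0} = V - vert ` X" by (auto simp: deg)
  then show ?thesis by (auto simp: mc_signature_def mc_wt_def deg)
qed

text \<open>Monomer-dimer partition function of a weighted graph, given by its edge list, restricted to
  the vertices in \<open>U\<close>.\<close>

fun monomer_dimer :: "(nat \<Rightarrow> rat) \<Rightarrow> (nat \<times> nat \<times> rat) list \<Rightarrow> nat set \<Rightarrow> rat" where
  "monomer_dimer lam [] U = (\<Prod>v\<in>U. lam v)"
| "monomer_dimer lam ((u, v, c) # es) U = monomer_dimer lam es U +
    (if u \<in> U \<and> v \<in> U then c * monomer_dimer lam es (U - {u, v}) else 0)"

text \<open>One external edge is attached to each terminal \<open>\<tau> i\<close>. Using it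
  occupies the terminal, which has the same effect as deleting that vertex from the graph.\<close>

lemma has_matchings_circuit_monomer_dimer:
  fixes \<tau> :: "'j::finite \<Rightarrow> nat"
  assumes V: "finite V" and \<tau>: "inj \<tau>" "range \<tau> \<subseteq> V"
    and es: "\<And>u v c. (u, v, c) \<in> set es \<Longrightarrow> u \<in> V \<and> v \<in> V \<and> u \<noteq> v \<and> c \<ge> 0"
    and lam: "\<And>v. v \<in> V \<Longrightarrow> lam v \<ge> 0"
  shows "has_matchings_circuit (\<lambda>x. monomer_dimer lam es (V - \<tau> ` {i. x i}))"
proof -
  define n where "n = CARD('j)"
  obtain \<sigma> :: "'j \<Rightarrow> nat" where \<sigma>: "bij_betw \<sigma> UNIV {..<n}"
    using ex_bij_betw_finite_nat[of "UNIV :: 'j set"] by (auto simp: n_def atLeast0LessThan)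
  \<comment> \<open>The induction adds edges at the end of a list, whereas
    \<open>monomer_dimer\<close> peels them off the front.\<close>
  define edges where "edges = rev es"
  \<comment> \<open>External edge \<open>i\<close> is the incidence \<open>\<sigma> i < n\<close>; the \<open>k\<close>-th internal edge has the two
    incidences \<open>n + 2 * k\<close> and \<open>n + 2 * k + 1\<close>.\<close>
  define vert where "vert j = (if j < n then \<tau> (inv \<sigma> j)
    else if even (j - n) then fst (edges ! ((j - n) div 2)) else fst (snd (edges ! ((j - n) div 2))))" for j
  define edge where "edge k = {n + 2 * k, n + 2 * k + 1}" for k :: nat
  define w where "w e = snd (snd (edges ! ((Min e - n) div 2)))" for e
  define E where "E m = edge ` {..<m}" for m
  have inj_\<sigma>: "inj \<sigma>" and ran_\<sigma>: "range \<sigma> = {..<n}" using \<sigma> by (auto simp: bij_betw_def)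
  have vert_\<sigma>: "vert (\<sigma> i) = \<tau> i" for i
    using inj_\<sigma> ran_\<sigma> by (auto simp: vert_def)
  have vert_edge: "vert (n + 2 * k) = fst (edges ! k)" "vert (n + 2 * k + 1) = fst (snd (edges ! k))" for k
    by (auto simp: vert_def)
  have w_edge: "w (edge k) = snd (snd (edges ! k))" for k
  proof -
    have "Min (edge k) = n + 2 * k" by (simp add: edge_def)
    then show ?thesis by (simp add: w_def)
  qed
  have edges: "fst (edges ! k) \<in> V \<and> fst (snd (edges ! k)) \<in> V \<and> fst (edges ! k) \<noteq> fst (snd (edges ! k))
      \<and> snd (snd (edges ! k)) \<ge> 0" if "k < length es" for k
  proof -
    have "edges ! k \<in> set es" using that by (metis edges_def length_rev nth_mem set_rev)
    then show ?thesis using es by (metis prod.collapse)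
  qed
  have disj: "edge k \<inter> edge l = {}" if "k \<noteq> l" for k l
  proof -
    have "2 * k \<noteq> Suc (2 * l)" "2 * l \<noteq> Suc (2 * k)" by presburger+
    then show ?thesis using that by (auto simp: edge_def)
  qed
  have fresh: "edge m \<notin> E m" for m
  proof
    assume "edge m \<in> E m"
    then obtain k where "k < m" "edge m = edge k" by (auto simp: E_def)
    then show False using disj[of m k] by (auto simp: edge_def)
  qed
  \<comment> \<open>Here \<open>X\<close> is arbitrary because it absorbs, besides the external
    incidences, those of internal edges with index at least \<open>m\<close> that were already
    chosen.\<close>
  have sig: "mc_signature V vert (E m) w lam X = monomer_dimer lam (rev (take m edges)) (V - vert ` X)"
    if "m \<le> length es" "finite X" "inj_on vert X" "\<And>k. k < m \<Longrightarrow> X \<inter> edge k = {}" for m X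
    using that
  proof (induction m arbitrary: X)
    case 0
    then show ?case by (simp add: E_def mc_signature_no_edges)
  next
    case (Suc m)
    obtain u v c where uvc: "edges ! m = (u, v, c)" by (metis prod.collapse)
    have uv: "u \<in> V" "v \<in> V" "u \<noteq> v" using edges[of m] Suc.prems(1) uvc by auto
    have vert_m: "vert (n + 2 * m) = u" "vert (n + 2 * m + 1) = v" using vert_edge[of m] uvc by auto
    have vert_e: "vert ` edge m = {u, v}" using vert_m by (simp add: edge_def)
    have "E (Suc m) = insert (edge m) (E m)" by (auto simp: E_def lessThan_Suc)
    then have "mc_signature V vert (E (Suc m)) w lam X = mc_signature V vert (E m) w lam X
        + c * mc_signature V vert (E m) w lam (X \<union> edge m)"
      using mc_signature_insert_edge[OF _ fresh[of m]] w_edge[of m] uvc by (simp add: E_def)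
    moreover have "mc_signature V vert (E m) w lam X = monomer_dimer lam (rev (take m edges)) (V - vert ` X)"
      by (rule Suc.IH) (use Suc.prems in auto)
    moreover have "mc_signature V vert (E m) w lam (X \<union> edge m) =
      (if u \<notin> vert ` X \<and> v \<notin> vert ` X then monomer_dimer lam (rev (take m edges)) (V - vert ` X - {u, v}) else 0)"
    proof (cases "u \<notin> vert ` X \<and> v \<notin> vert ` X")
      case True
      have vert_Un: "vert ` (X \<union> edge m) = vert ` X \<union> {u, v}" by (simp add: image_Un vert_e)
      have "inj_on vert (edge m)" using vert_m uv by (auto simp: edge_def inj_on_def)
      moreover have "vert ` X \<inter> vert ` edge m = {}" using True vert_e by simp
      ultimately have "inj_on vert (X \<union> edge m)"
        using Suc.prems(3) unfolding inj_on_Un by blast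
      then have "mc_signature V vert (E m) w lam (X \<union> edge m)
          = monomer_dimer lam (rev (take m edges)) (V - vert ` (X \<union> edge m))"
      proof (intro Suc.IH)
        show "(X \<union> edge m) \<inter> edge k = {}" if "k < m" for k
          using Suc.prems(4)[of k] disj[of m k] that by auto
      qed (use Suc.prems in \<open>auto simp: edge_def\<close>)
      moreover have "V - vert ` (X \<union> edge m) = V - vert ` X - {u, v}" unfolding vert_Un by auto
      ultimately show ?thesis using True by simp
    next
      case False
      then obtain i j where "i \<in> X" "j \<in> edge m" "vert i = vert j"
        using vert_e by (metis imageE insertCI)
      moreover have "i \<noteq> j" using Suc.prems(4)[of m] calculation by auto
      moreover have "vert j \<in> V" using uv vert_m \<open>j \<in> edge m\<close> by (auto simp: edge_def)
      ultimately have "mc_signature V vert (E m) w lam (X \<union> edge m) = 0"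
        by (intro mc_signature_conflict[of _ _ i j]) (use Suc.prems in \<open>auto simp: E_def edge_def\<close>)
      then show ?thesis using False by auto
    qed
    moreover have "take (Suc m) edges = take m edges @ [(u, v, c)]"
      using uvc Suc.prems(1) by (simp add: take_Suc_conv_app_nth edges_def)
    ultimately show ?case using uv by simp
  qed
  let ?N = "length es" and ?J = "{..<n + 2 * length es}"
  have "is_matchings_circuit ?J V vert {..<n} (E ?N) w lam"
    unfolding is_matchings_circuit_def
  proof (intro conjI ballI impI)
    show "vert ` ?J \<subseteq> V"
    proof (intro image_subsetI)
      fix j assume j: "j \<in> ?J"
      show "vert j \<in> V"
      proof (cases "j < n")
        case True
        then show ?thesis using \<tau>(2) by (auto simp: vert_def)
      next
        case False
        then have "(j - n) div 2 < length es" using j by auto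
        then show ?thesis using edges False by (auto simp: vert_def)
      qed
    qed
    show "\<Union>(E ?N) = ?J - {..<n}"
    proof
      show "\<Union>(E ?N) \<subseteq> ?J - {..<n}" by (auto simp: E_def edge_def)
      show "?J - {..<n} \<subseteq> \<Union>(E ?N)"
      proof
        fix j assume j: "j \<in> ?J - {..<n}"
        have "j - n = 2 * ((j - n) div 2) \<or> j - n = 2 * ((j - n) div 2) + 1" by presburger
        then have "j \<in> edge ((j - n) div 2)" using j unfolding edge_def by auto
        moreover have "(j - n) div 2 < ?N" using j by auto
        ultimately show "j \<in> \<Union>(E ?N)" by (auto simp: E_def)
      qed
    qed
    show "w e \<ge> 0" if "e \<in> E ?N" for e
      using that w_edge edges by (auto simp: E_def)
    show "e \<inter> e' = {}" if "e \<in> E ?N" "e' \<in> E ?N" "e \<noteq> e'" for e e'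
    proof -
      from that obtain k l where "e = edge k" "e' = edge l" by (auto simp: E_def)
      then show ?thesis using disj[of k l] that(3) by auto
    qed
    show "card e = 2" if "e \<in> E ?N" for e using that by (auto simp: E_def edge_def)
  qed (use V lam in auto)
  moreover have "monomer_dimer lam es (V - \<tau> ` {i. x i}) = mc_signature V vert (E ?N) w lam (\<sigma> ` {i. x i})" for x
  proof -
    have "vert ` \<sigma> ` {i. x i} = \<tau> ` {i. x i}" by (simp add: image_image vert_\<sigma>)
    moreover have "inj_on vert (\<sigma> ` {i. x i})"
      using \<tau>(1) by (auto simp: inj_on_def vert_\<sigma> inj_def)
    moreover have "\<sigma> ` {i. x i} \<inter> edge k = {}" for k
    proof -
      have "\<sigma> ` {i. x i} \<subseteq> {..<n}" using ran_\<sigma> by blast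
      then show ?thesis by (auto simp: edge_def)
    qed
    ultimately show ?thesis by (subst sig) (simp_all add: edges_def)
  qed
  ultimately show ?thesis unfolding has_matchings_circuit_def using \<sigma> by blast
qed

section \<open>Realising ternary functions\<close>

text \<open>With \<open>p a\<close> largest and \<open>p d\<close> smallest, the remaining demands
  \<open>p a - p d\<close>, \<open>p b\<close>, \<open>p c\<close> satisfy the triangle
  inequalities, so the usual half-differences solve the triangle with nonnegative weights.\<close>

lemma K4_edge_weights:
  fixes p :: "'k::finite \<Rightarrow> rat"
  assumes card: "CARD('k) = 4" and nonneg: "\<And>k. p k \<ge> 0"
    and le: "\<And>k. p k \<le> (\<Sum>l\<in>UNIV - {k}. p l)"
  shows "\<exists>e. (\<forall>k l. e k l \<ge> 0) \<and> (\<forall>k l. e k l = e l k) \<and> (\<forall>k. e k k = 0) \<and>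
    (\<forall>k. p k = (\<Sum>l\<in>UNIV. e k l))"
proof -
  obtain a where a: "\<And>k. p k \<le> p a"
    using Max_in[of "range p"] Max_ge[of "range p"]
    by (metis UNIV_not_empty finite finite_imageI image_iff image_is_empty rangeI)
  have card': "card (UNIV - {a}) = 3" using card by simp
  then have "UNIV - {a} \<noteq> {}" by (metis card.empty numeral_eq_iff zero_neq_numeral)
  then have "\<exists>d\<in>UNIV - {a}. \<forall>k\<in>UNIV - {a}. p d \<le> p k"
    using ex_min_if_finite[of "p ` (UNIV - {a})"] by (auto simp: not_less)
  then obtain d where d: "d \<noteq> a" "\<And>k. k \<noteq> a \<Longrightarrow> p d \<le> p k" by blast
  have "card (UNIV - {a} - {d}) = 2" using card' d by simp
  then obtain b c where bc: "UNIV - {a} - {d} = {b, c}" "b \<noteq> c" by (meson card_2_iff)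
  have U: "UNIV = {a, b, c, d}" using bc by auto
  have distinct: "a \<noteq> b" "a \<noteq> c" "a \<noteq> d" "b \<noteq> c" "b \<noteq> d" "c \<noteq> d" using bc d by auto
  have le_a: "p a \<le> p b + p c + p d"
    using le[of a] distinct unfolding U by (simp add: insert_Diff_if)
  \<comment> \<open>Spend the smallest demand entirely on the largest one; the rest is a triangle.\<close>
  define e where "e k l =
    (if {k, l} = {a, d} then p d
     else if {k, l} = {a, b} then (p a - p d + p b - p c) / 2
     else if {k, l} = {a, c} then (p a - p d + p c - p b) / 2
     else if {k, l} = {b, c} then (p b + p c + p d - p a) / 2 else 0)" for k l
  have "p k = (\<Sum>l\<in>UNIV. e k l)" for k
  proof -
    have "k \<in> {a, b, c, d}" using U by auto
    then show ?thesis unfolding U using distinct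
      by (auto simp: e_def doubleton_eq_iff field_simps)
  qed
  moreover have "e k l \<ge> 0" for k l
    using nonneg[of d] a[of b] a[of c] d(2)[of b] d(2)[of c] distinct le_a by (simp add: e_def)
  moreover have "e k l = e l k" for k l by (simp add: e_def insert_commute)
  moreover have "e k k = 0" for k using distinct by (auto simp: e_def doubleton_eq_iff)
  ultimately show ?thesis by blast
qed

lemma symmetric_weighted_system:
  fixes g h :: "'k::finite \<Rightarrow> rat" and e :: "'k \<Rightarrow> 'k \<Rightarrow> rat"
  assumes g: "\<And>k. g k \<ge> 0" and h: "\<And>k. h k \<ge> 0" and m: "g m \<noteq> 0"
    and e: "\<And>k l. e k l \<ge> 0" "\<And>k l. e k l = e l k" "\<And>k. e k k = 0"
    and sum: "\<And>k. g k * h k = (\<Sum>l\<in>UNIV. e k l)"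
  shows "\<exists>c. (\<forall>k l. c k l \<ge> 0) \<and> (\<forall>k l. c k l = c l k) \<and> (\<forall>k. c k k = 0) \<and>
    (\<forall>k. h k = (\<Sum>l\<in>UNIV. c k l * g l))"
proof -
  \<comment> \<open>A nonnegative row with sum \<open>g l * h l = 0\<close> vanishes, so nothing is
    lost by dividing only where \<open>g\<close> is nonzero.\<close>
  have e0: "e k l = 0" if "g l = 0" for k l
  proof -
    have "(\<Sum>k\<in>UNIV. e l k) = 0" using sum[of l] that by simp
    then show ?thesis using e by (simp add: sum_nonneg_eq_0_iff)
  qed
  \<comment> \<open>Where \<open>g\<close> vanishes, \<open>h\<close> is unconstrained and is produced through the single index \<open>m\<close>.\<close>
  define c where "c k l = (if g k \<noteq> 0 \<and> g l \<noteq> 0 then e k l / (g k * g l)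
    else if g k = 0 \<and> l = m then h k / g m else if k = m \<and> g l = 0 then h l / g m else 0)" for k l
  have "h k = (\<Sum>l\<in>UNIV. c k l * g l)" for k
  proof (cases "g k = 0")
    case True
    then have "(\<Sum>l\<in>UNIV. c k l * g l) = (\<Sum>l\<in>UNIV. if l = m then h k else 0)"
      by (intro sum.cong) (use m in \<open>auto simp: c_def\<close>)
    then show ?thesis by simp
  next
    case False
    then have "(\<Sum>l\<in>UNIV. c k l * g l) = (\<Sum>l\<in>UNIV. e k l / g k)"
      by (intro sum.cong) (auto simp: c_def e0)
    also have "\<dots> = h k" using sum[of k] False by (simp add: sum_divide_distrib[symmetric] field_simps)
    finally show ?thesis by simp
  qed
  moreover have "c k l = c l k" for k l using e(2) m by (auto simp: c_def mult.commute)
  moreover have "c k l \<ge> 0" for k l using e(1) g h by (simp add: c_def)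
  moreover have "c k k = 0" for k using e(3) m by (auto simp: c_def)
  ultimately show ?thesis by blast
qed

section \<open>Two explicit circuits for ternary functions\<close>

lemma inj_3:
  assumes "f 0 \<noteq> f 1" "f 0 \<noteq> f 2" "f 1 \<noteq> f 2"
  shows "inj (f :: 3 \<Rightarrow> 'a)"
proof (rule injI)
  fix i j assume "f i = f j"
  then show "i = j" using exhaust_3_from_0[of i] exhaust_3_from_0[of j] assms by auto
qed

lemma image_vec3:
  "f ` {i. vec3 a b c i} = (if a then {f 0} else {}) \<union> (if b then {f 1} else {}) \<union> (if c then {f 2} else {})"
proof -
  have "f ` {i. vec3 a b c i} = f ` {i \<in> UNIV. vec3 a b c i}" by simp
  then show ?thesis unfolding UNIV_3_from_0 by (auto simp: vec3_def)
qed

lemma has_matchings_circuit_if_system: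
  fixes F :: "(3 \<Rightarrow> bool) \<Rightarrow> rat"
  assumes nonneg: "\<And>x. F x \<ge> 0"
    and c: "c01 \<ge> 0" "c02 \<ge> 0" "c03 \<ge> 0" "c12 \<ge> 0" "c13 \<ge> 0" "c23 \<ge> 0"
    and F: "F (vec3 False False False) = c01 * F (vec3 False True True) + c02 * F (vec3 True False True) + c03 * F (vec3 True True False)"
      "F (vec3 True False False) = c01 * F (vec3 True True True) + c12 * F (vec3 True False True) + c13 * F (vec3 True True False)"
      "F (vec3 False True False) = c02 * F (vec3 True True True) + c12 * F (vec3 False True True) + c23 * F (vec3 True True False)"
      "F (vec3 False False True) = c03 * F (vec3 True True True) + c13 * F (vec3 False True True) + c23 * F (vec3 True False True)"
  shows "has_matchings_circuit F"
proof -
  \<comment> \<open>A complete graph on the terminals 0, 1, 2, a vertex 3 that may stay unmatched, and a hub 4.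
    A matching of nonzero weight covers the hub, so its weight has one of the four values of \<open>F\<close>
    at 011, 101, 110, 111 as a factor.\<close>
  define \<tau> :: "3 \<Rightarrow> nat" where "\<tau> i = (if i = 0 then 0 else if i = 1 then 1 else 2)" for i
  define lam :: "nat \<Rightarrow> rat" where "lam v = (if v = 3 then 1 else 0)" for v
  \<comment> \<open>Let vertex 3 stand for index 0 and vertex \<open>k - 1\<close> for index
    \<open>k\<close> in 1, 2, 3. The coefficient with indices \<open>k\<close> and \<open>l\<close>
    sits on the edge avoiding both their vertices: if that of \<open>k\<close> is removed or
    unmatched and the hub takes that of \<open>l\<close>, the other two must be joined.\<close>
  define es :: "(nat \<times> nat \<times> rat) list" where "es =
    [(0, 4, F (vec3 False True True)), (1, 4, F (vec3 True False True)), (2, 4, F (vec3 True True False)),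
     (3, 4, F (vec3 True True True)), (0, 1, c03), (0, 2, c02), (1, 2, c01), (0, 3, c23), (1, 3, c13), (2, 3, c12)]"
  have \<tau>: "\<tau> 0 = 0" "\<tau> 1 = 1" "\<tau> 2 = 2" by (simp_all add: \<tau>_def)
  have "has_matchings_circuit (\<lambda>x. monomer_dimer lam es ({0, 1, 2, 3, 4} - \<tau> ` {i. x i}))"
  proof (rule has_matchings_circuit_monomer_dimer)
    show "inj \<tau>" by (rule inj_3) (simp_all add: \<tau>)
    show "range \<tau> \<subseteq> {0, 1, 2, 3, 4}" by (auto simp: \<tau>_def)
  qed (use nonneg c in \<open>auto simp: es_def lam_def\<close>)
  moreover have "monomer_dimer lam es ({0, 1, 2, 3, 4} - \<tau> ` {i. x i}) = F x" for x
  proof -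
    obtain a b c where x: "x = vec3 a b c" using vec3_exhaust by blast
    show ?thesis unfolding x image_vec3 \<tau> es_def
      by (cases a; cases b; cases c) (simp_all add: lam_def insert_Diff_if F algebra_simps)
  qed
  ultimately show ?thesis by simp
qed

lemma has_matchings_circuit_if_weight_le_1:
  fixes F :: "(3 \<Rightarrow> bool) \<Rightarrow> rat"
  assumes nonneg: "\<And>x. F x \<ge> 0"
    and F: "F (vec3 True True True) = 0" "F (vec3 False True True) = 0"
      "F (vec3 True False True) = 0" "F (vec3 True True False) = 0"
  shows "has_matchings_circuit F"
proof -
  \<comment> \<open>Each terminal has a partner in \<open>{3, 4, 5}\<close>, which is free to be matched to the hub 6 only
    if its terminal is removed.\<close>
  define \<tau> :: "3 \<Rightarrow> nat" where "\<tau> i = (if i = 0 then 0 else if i = 1 then 1 else 2)" for i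
  define lam :: "nat \<Rightarrow> rat" where "lam v = (if v = 6 then F (vec3 False False False) else 0)" for v
  define es :: "(nat \<times> nat \<times> rat) list" where "es =
    [(0, 3, 1), (1, 4, 1), (2, 5, 1), (3, 6, F (vec3 True False False)),
     (4, 6, F (vec3 False True False)), (5, 6, F (vec3 False False True))]"
  have \<tau>: "\<tau> 0 = 0" "\<tau> 1 = 1" "\<tau> 2 = 2" by (simp_all add: \<tau>_def)
  have "has_matchings_circuit (\<lambda>x. monomer_dimer lam es ({0, 1, 2, 3, 4, 5, 6} - \<tau> ` {i. x i}))"
  proof (rule has_matchings_circuit_monomer_dimer)
    show "inj \<tau>" by (rule inj_3) (simp_all add: \<tau>)
    show "range \<tau> \<subseteq> {0, 1, 2, 3, 4, 5, 6}" by (auto simp: \<tau>_def)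
  qed (use nonneg in \<open>auto simp: es_def lam_def\<close>)
  \<comment> \<open>Two freed partners would compete for the hub, so the value is 0. With no
    terminal removed the hub stays unmatched and contributes its fugacity.\<close>
  moreover have "monomer_dimer lam es ({0, 1, 2, 3, 4, 5, 6} - \<tau> ` {i. x i}) = F x" for x
  proof -
    obtain a b c where x: "x = vec3 a b c" using vec3_exhaust by blast
    show ?thesis unfolding x image_vec3 \<tau> es_def
      by (cases a; cases b; cases c) (simp_all add: lam_def insert_Diff_if F)
  qed
  ultimately show ?thesis by simp
qed

lemma antipodal_ineq_has_matchings_circuit:
  fixes F :: "(3 \<Rightarrow> bool) \<Rightarrow> rat"
  assumes nonneg: "\<And>x. F x \<ge> 0"
    and ineq: "\<And>x1 x2 x3.
      F (vec3 x1 x2 x3) * F (vec3 (\<not>x1) (\<not>x2) (\<not>x3))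
      \<le> F (vec3 x1 x2 (\<not>x3)) * F (vec3 (\<not>x1) (\<not>x2) x3)
       + F (vec3 x1 (\<not>x2) x3) * F (vec3 (\<not>x1) x2 (\<not>x3))
       + F (vec3 x1 (\<not>x2) (\<not>x3)) * F (vec3 (\<not>x1) x2 x3)"
  shows "has_matchings_circuit F"
proof -
  \<comment> \<open>The final branch is index 4, which equals 0 in the type
    \<open>4\<close>.\<close>
  define g :: "4 \<Rightarrow> rat" where "g k = (if k = 1 then F (vec3 False True True)
    else if k = 2 then F (vec3 True False True) else if k = 3 then F (vec3 True True False)
    else F (vec3 True True True))" for k
  define h :: "4 \<Rightarrow> rat" where "h k = (if k = 1 then F (vec3 True False False)
    else if k = 2 then F (vec3 False True False) else if k = 3 then F (vec3 False False True)
    else F (vec3 False False False))" for k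
  show ?thesis
  proof (cases "\<exists>m. g m \<noteq> 0")
    case False
    then have "g 1 = 0" "g 2 = 0" "g 3 = 0" "g 4 = 0" by auto
    then show ?thesis by (intro has_matchings_circuit_if_weight_le_1 nonneg) (simp_all add: g_def)
  next
    case True
    then obtain m where m: "g m \<noteq> 0" by blast
    have g0: "g k \<ge> 0" and h0: "h k \<ge> 0" for k using nonneg by (simp_all add: g_def h_def)
    have "g k * h k \<le> (\<Sum>l\<in>UNIV - {k}. g l * h l)" for k
    proof -
      \<comment> \<open>Adding \<open>g k * h k\<close> to both sides makes the right side
        independent of \<open>k\<close>.\<close>
      have "2 * (g k * h k) \<le> (\<Sum>l\<in>UNIV. g l * h l)"
        using exhaust_4[of k] ineq[of False True True] ineq[of True False True]
          ineq[of True True False] ineq[of True True True]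
        unfolding sum_4 by (auto simp: g_def h_def mult.commute)
      then show ?thesis by (simp add: sum_diff1)
    qed
    then obtain e :: "4 \<Rightarrow> 4 \<Rightarrow> rat" where "\<forall>k l. e k l \<ge> 0" "\<forall>k l. e k l = e l k" "\<forall>k. e k k = 0"
      "\<forall>k. g k * h k = (\<Sum>l\<in>UNIV. e k l)"
      using K4_edge_weights[of "\<lambda>k. g k * h k"] g0 h0 by auto
    then obtain c where c: "\<forall>k l. c k l \<ge> 0" "\<forall>k l. c k l = c l k" "\<forall>k. c k k = 0"
      "\<forall>k. h k = (\<Sum>l\<in>UNIV. c k l * g l)"
      using symmetric_weighted_system[of g h m e] g0 h0 m by blast
    have h: "h k = c k 1 * g 1 + c k 2 * g 2 + c k 3 * g 3 + c k 4 * g 4" for k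
      using c(4) by (simp add: sum_4)
    have sym: "c 2 1 = c 1 2" "c 3 1 = c 1 3" "c 3 2 = c 2 3" "c 1 4 = c 4 1" "c 2 4 = c 4 2" "c 3 4 = c 4 3"
      using c(2) by blast+
    have z: "c k k = 0" for k using c(3) by blast
    show ?thesis
    proof (rule has_matchings_circuit_if_system[OF nonneg])
      show "c 4 1 \<ge> 0" "c 4 2 \<ge> 0" "c 4 3 \<ge> 0" "c 1 2 \<ge> 0" "c 1 3 \<ge> 0" "c 2 3 \<ge> 0"
        using c(1) by blast+
    qed (use h[of 1] h[of 2] h[of 3] h[of 4] sym z[of 1] z[of 2] z[of 3] z[of 4]
        in \<open>simp_all add: g_def h_def\<close>)
  qed
qed

theorem theorem4:
  fixes F :: "(3 \<Rightarrow> bool) \<Rightarrow> rat"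
  assumes nonneg: "\<forall>x. F x \<ge> 0"
  shows "(windable F \<longleftrightarrow>
           (\<forall>x1 x2 x3.
              F (vec3 x1 x2 x3) * F (vec3 (\<not>x1) (\<not>x2) (\<not>x3))
              \<le> F (vec3 x1 x2 (\<not>x3)) * F (vec3 (\<not>x1) (\<not>x2) x3)
               + F (vec3 x1 (\<not>x2) x3) * F (vec3 (\<not>x1) x2 (\<not>x3))
               + F (vec3 x1 (\<not>x2) (\<not>x3)) * F (vec3 (\<not>x1) x2 x3)))
       \<and> (windable F \<longleftrightarrow> has_matchings_circuit F)"
proof -
  let ?ineq = "\<forall>x1 x2 x3.
    F (vec3 x1 x2 x3) * F (vec3 (\<not>x1) (\<not>x2) (\<not>x3))
    \<le> F (vec3 x1 x2 (\<not>x3)) * F (vec3 (\<not>x1) (\<not>x2) x3)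
     + F (vec3 x1 (\<not>x2) x3) * F (vec3 (\<not>x1) x2 (\<not>x3))
     + F (vec3 x1 (\<not>x2) (\<not>x3)) * F (vec3 (\<not>x1) x2 x3)"
  have "?ineq" if "windable F"
  proof (intro allI)
    fix x1 x2 x3
    have "F (vec3 x1 x2 x3) * F (vec3 (\<not>x1) (\<not>x2) (\<not>x3))
      \<le> (\<Sum>i\<in>UNIV. F (xorv (vec3 x1 x2 x3) (charv {i})) *
          F (xorv (vec3 (\<not>x1) (\<not>x2) (\<not>x3)) (charv {i})))"
      using windable_antipodal_le[OF that, of "vec3 x1 x2 x3"] by (simp add: not_vec3)
    then show "F (vec3 x1 x2 x3) * F (vec3 (\<not>x1) (\<not>x2) (\<not>x3))
      \<le> F (vec3 x1 x2 (\<not>x3)) * F (vec3 (\<not>x1) (\<not>x2) x3)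
       + F (vec3 x1 (\<not>x2) x3) * F (vec3 (\<not>x1) x2 (\<not>x3))
       + F (vec3 x1 (\<not>x2) (\<not>x3)) * F (vec3 (\<not>x1) x2 x3)"
      unfolding UNIV_3_from_0 by (simp add: xorv_vec3 algebra_simps)
  qed
  moreover have "has_matchings_circuit F" if "?ineq"
    using antipodal_ineq_has_matchings_circuit[of F] nonneg that by blast
  moreover note has_matchings_circuit_windable[of F]
  ultimately show ?thesis by blast
qed

end
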